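(* Let $p$ be a prime. For any ordinal $\alpha$ the inverse sequence of abelian groups $S(E_\alpha)$ is local and $$\mathrm{len}(S(E_\alpha))=\alpha.$$
   Context: An inverse sequence of abelian groups $S$ consists of abelian groups $S_i$ and homomorphisms $f_i:S_{i+1}\to S_i$, $i\in\omega=\{0,1,2,\dots\}$. $\lim S$ and $\lim^1S$ are the kernel and the cokernel of $1-F:\prod_iS_i\to\prod_iS_i$, $\mathrm{pr}_jF=f_j\mathrm{pr}_{j+1}$. $S$ is local if $\lim S=\lim^1S=0$. Let $I(S)\subseteq S$ be given by $I(S)_i=\mathrm{Im}(f_i:S_{i+1}\to S_i)$; put $I^0(S)=S$, $I^{\beta+1}(S)=I(I^\beta(S))$, and $I^\lambda(S)=\lim_{\beta<\lambda}I^\beta(S)$ (the componentwise intersection) for a limit ordinal $\lambda$. The length $\mathrm{len}(S)$ is the least ordinal $\mu$ such that $I^\beta(S)\rightarrowtail I^{\mu}(S)$ is an isomorphism for every $\beta>\mu$. For an abelian group $A$: $S(A)$ is the inverse sequence with $S(A)_i=A$ and $f_i(a)=pa$ for all $i$. Also $p^0A=A$, $p^{\beta+1}A=p\cdot(p^\beta A)$, and $p^\lambda A=\bigcap_{\beta<\lambda}p^\beta A$ for a limit ordinal $\lambda$. Construction of $E_\alpha$: let $\alpha^\diamond$ be the set of all finite increasing sequences of ordinals $(\alpha_1,\dots,\alpha_n)$ with $\alpha_1<\dots<\alpha_n<\alpha$, $n\ge1$. Let $\mathbb{Z}_p$ be the $p$-adic integers, $P_\alpha=\prod_{\sigma\in\alpha^\diamond}\mathbb{Z}_p$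 and $P'_\alpha=\bigoplus_{\sigma\in\alpha^\diamond}\mathbb{Z}_p\subseteq P_\alpha$, with standard basis $(e_\sigma)_{\sigma\in\alpha^\diamond}$ of $P'_\alpha$ over $\mathbb{Z}_p$. Let $R_\alpha\subseteq P'_\alpha$ be the $\mathbb{Z}_p$-submodule generated by the elements $r_{\alpha_1}=pe_{\alpha_1}$ and $r_{\alpha_1,\dots,\alpha_n}=pe_{\alpha_1,\dots,\alpha_n}-e_{\alpha_2,\dots,\alpha_n}$ for $n\ge2$. Put $D_\alpha=P_\alpha/R_\alpha$ and $E_\alpha=D_\alpha/p^\alpha D_\alpha$. *)

theory Defs
  imports "HOL-Algebra.Algebra"
begin

section \<open>Transfinite iteration\<close>

text \<open>
  Ordinals are the elements of a well-ordered type without a largest element (so that every element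
  has a successor); an element stands for the order type of the set of elements below it. Every
  ordinal arises in this way in some type, and the construction of the iterates at an ordinal
  involves smaller ordinals only, so it does not depend on the surrounding type.
\<close>

definition osuc :: "'o::wellorder \<Rightarrow> 'o" where
  "osuc b = (LEAST c. b < c)"

text \<open>In the second case, \<open>b\<close> is the successor of a (unique) \<open>c\<close>; the third is the limit case.\<close>

function titer :: "('x \<Rightarrow> 'x) \<Rightarrow> 'x::complete_lattice \<Rightarrow> 'o::wellorder \<Rightarrow> 'x" where
  "titer F x b =
    (if \<forall>c. b \<le> c then x
     else if \<exists>c<b. b = osuc c then F (titer F x (SOME c. c < b \<and> b = osuc c))
     else (INF c\<in>{..<b}. titer F x c))"
  by pat_completeness auto
termination
proof (relation "inv_image {(b, c). b < c} (\<lambda>(F, x, b). b)", goal_cases)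
  case 1
  show ?case by (intro wf_inv_image wf)
next
  case (2 F x b)
  then have "\<exists>c. c < b \<and> b = osuc c" by blast
  from someI_ex[OF this] show ?case by simp
qed auto

declare titer.simps [simp del]

lemma osuc_greater: "(b::'o::{wellorder,no_top}) < osuc b"
  unfolding osuc_def using gt_ex by (rule LeastI_ex)

lemma osuc_least: "b < c \<Longrightarrow> osuc b \<le> c"
  unfolding osuc_def by (rule Least_le)

lemma osuc_inject: "osuc b = osuc c \<Longrightarrow> b = (c::'o::{wellorder,no_top})"
  by (metis leD not_less_iff_gr_or_eq osuc_greater osuc_least)

lemma titer_zero: "(\<And>c. b \<le> c) \<Longrightarrow> titer F x b = x"
  by (simp add: titer.simps)

lemma titer_osuc: "titer F x (osuc b) = F (titer F x (b::'o::{wellorder,no_top}))"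
proof -
  have "(SOME c. c < osuc b \<and> osuc b = osuc c) = b"
    using osuc_greater by (intro some_equality) (auto dest: osuc_inject)
  moreover have "\<exists>c < osuc b. osuc b = osuc c" "\<not> (\<forall>c. osuc b \<le> c)"
    using osuc_greater[of b] by (auto simp: not_le)
  ultimately show ?thesis
    by (subst titer.simps) (simp only: if_False if_True)
qed

lemma titer_limit:
  fixes b :: "'o::{wellorder,no_top}"
  assumes "a < b" and "\<And>c. c < b \<Longrightarrow> osuc c < b"
  shows "titer F x b = (INF c\<in>{..<b}. titer F x c)"
proof -
  have "\<not> (\<forall>c. b \<le> c)" "\<not> (\<exists>c<b. b = osuc c)"
    using assms by (auto simp: not_le)
  then show ?thesis
    by (subst titer.simps) (simp only: if_False)
qed


section \<open>Inverse sequences of abelian groups\<close>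

text \<open>
  Abelian groups are commutative groups in the sense of \<open>HOL-Algebra\<close>, written multiplicatively;
  thus \<open>p\<close> times \<open>a\<close> reads \<open>a [^] p\<close>.
\<close>

record 'a invseq =
  grp :: "nat \<Rightarrow> 'a monoid"
  bond :: "nat \<Rightarrow> 'a \<Rightarrow> 'a"

definition is_invseq :: "'a invseq \<Rightarrow> bool" where
  "is_invseq S \<longleftrightarrow>
    (\<forall>i. comm_group (grp S i)) \<and> (\<forall>i. bond S i \<in> hom (grp S (Suc i)) (grp S i))"

definition seq_prod :: "'a invseq \<Rightarrow> (nat \<Rightarrow> 'a) monoid" where
  "seq_prod S = product_group UNIV (grp S)"

definition shift_map :: "'a invseq \<Rightarrow> (nat \<Rightarrow> 'a) \<Rightarrow> (nat \<Rightarrow> 'a)" where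
  "shift_map S x = (\<lambda>j. bond S j (x (Suc j)))"

definition one_minus_shift :: "'a invseq \<Rightarrow> (nat \<Rightarrow> 'a) \<Rightarrow> (nat \<Rightarrow> 'a)" where
  "one_minus_shift S x = x \<otimes>\<^bsub>seq_prod S\<^esub> inv\<^bsub>seq_prod S\<^esub> (shift_map S x)"

definition lim_group :: "'a invseq \<Rightarrow> (nat \<Rightarrow> 'a) monoid" where
  "lim_group S = (seq_prod S)\<lparr>carrier := kernel (seq_prod S) (seq_prod S) (one_minus_shift S)\<rparr>"

definition lim1_group :: "'a invseq \<Rightarrow> (nat \<Rightarrow> 'a) set monoid" where
  "lim1_group S = seq_prod S Mod (one_minus_shift S ` carrier (seq_prod S))"

definition is_local :: "'a invseq \<Rightarrow> bool" where
  "is_local S \<longleftrightarrow> trivial_group (lim_group S) \<and> trivial_group (lim1_group S)"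

definition image_step :: "'a invseq \<Rightarrow> (nat \<Rightarrow> 'a set) \<Rightarrow> (nat \<Rightarrow> 'a set)" where
  "image_step S T = (\<lambda>i. bond S i ` T (Suc i))"

text \<open>
  All \<open>I\<^sup>b(S)\<close> are subobjects of \<open>S\<close>, so the iteration is carried out on the families of their
  underlying sets; the infimum in \<open>titer\<close> is then the componentwise intersection.
\<close>

definition I_pow :: "'a invseq \<Rightarrow> 'o::wellorder \<Rightarrow> 'a invseq" where
  "I_pow S b = S\<lparr>grp := (\<lambda>i. (grp S i)
     \<lparr>carrier := titer (image_step S) (\<lambda>i. carrier (grp S i)) b i\<rparr>)\<rparr>"

definition stable_from :: "'a invseq \<Rightarrow> 'o::wellorder \<Rightarrow> bool" where
  "stable_from S m \<longleftrightarrow>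
    (\<forall>b>m. \<forall>i. (\<lambda>a. a) \<in> iso (grp (I_pow S b) i) (grp (I_pow S m) i))"

definition has_len :: "'a invseq \<Rightarrow> 'o::wellorder \<Rightarrow> bool" where
  "has_len S m \<longleftrightarrow> stable_from S m \<and> (\<forall>n. stable_from S n \<longrightarrow> m \<le> n)"

definition mult_seq :: "nat \<Rightarrow> 'a monoid \<Rightarrow> 'a invseq" where
  "mult_seq p A = \<lparr>grp = (\<lambda>i. A), bond = (\<lambda>i a. a [^]\<^bsub>A\<^esub> p)\<rparr>"

definition p_pow :: "nat \<Rightarrow> 'a monoid \<Rightarrow> 'o::wellorder \<Rightarrow> 'a set" where
  "p_pow p A b = titer (\<lambda>B. (\<lambda>a. a [^]\<^bsub>A\<^esub> p) ` B) (carrier A) b"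


section \<open>The groups \<open>E\<^sub>\<alpha>\<close>\<close>

text \<open>
  The \<open>p\<close>-adic integers, as the inverse limit of the rings \<open>\<int>/p\<^sup>n\<close>: the \<open>n\<close>-th entry of an element is
  its residue modulo \<open>p\<^sup>n\<close>, represented in \<open>{0..<p\<^sup>n}\<close>.
\<close>

definition Zp :: "nat \<Rightarrow> (nat \<Rightarrow> int) ring" where
  "Zp p = \<lparr>
    carrier = {x. \<forall>n. x n \<in> {0..<int p ^ n} \<and> x (Suc n) mod int p ^ n = x n},
    monoid.mult = (\<lambda>x y n. (x n * y n) mod int p ^ n),
    one = (\<lambda>n. 1 mod int p ^ n),
    ring.zero = (\<lambda>n. 0),
    add = (\<lambda>x y n. (x n + y n) mod int p ^ n)\<rparr>"

definition diamond :: "'o::wellorder \<Rightarrow> 'o list set" where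
  "diamond \<alpha> = {s. s \<noteq> [] \<and> sorted_wrt (<) s \<and> (\<forall>b\<in>set s. b < \<alpha>)}"

text \<open>The ring multiplication of \<open>P_mod\<close> plays no role; it only fills the record field.\<close>

definition P_mod :: "nat \<Rightarrow> 'o::wellorder \<Rightarrow> (nat \<Rightarrow> int, 'o list \<Rightarrow> nat \<Rightarrow> int) module" where
  "P_mod p \<alpha> = \<lparr>
    carrier = (\<Pi>\<^sub>E s\<in>diamond \<alpha>. carrier (Zp p)),
    monoid.mult = (\<lambda>x y. \<lambda>s\<in>diamond \<alpha>. x s \<otimes>\<^bsub>Zp p\<^esub> y s),
    one = (\<lambda>s\<in>diamond \<alpha>. \<one>\<^bsub>Zp p\<^esub>),
    ring.zero = (\<lambda>s\<in>diamond \<alpha>. \<zero>\<^bsub>Zp p\<^esub>),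
    add = (\<lambda>x y. \<lambda>s\<in>diamond \<alpha>. x s \<oplus>\<^bsub>Zp p\<^esub> y s),
    smult = (\<lambda>c x. \<lambda>s\<in>diamond \<alpha>. c \<otimes>\<^bsub>Zp p\<^esub> x s)\<rparr>"

definition P'_mod :: "nat \<Rightarrow> 'o::wellorder \<Rightarrow> (nat \<Rightarrow> int, 'o list \<Rightarrow> nat \<Rightarrow> int) module" where
  "P'_mod p \<alpha> = (P_mod p \<alpha>)
     \<lparr>carrier := {x \<in> carrier (P_mod p \<alpha>). finite {s \<in> diamond \<alpha>. x s \<noteq> \<zero>\<^bsub>Zp p\<^esub>}}\<rparr>"

definition e_basis :: "nat \<Rightarrow> 'o::wellorder \<Rightarrow> 'o list \<Rightarrow> 'o list \<Rightarrow> nat \<Rightarrow> int" where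
  "e_basis p \<alpha> s = (\<lambda>t\<in>diamond \<alpha>. if t = s then \<one>\<^bsub>Zp p\<^esub> else \<zero>\<^bsub>Zp p\<^esub>)"

definition r_elem :: "nat \<Rightarrow> 'o::wellorder \<Rightarrow> 'o list \<Rightarrow> 'o list \<Rightarrow> nat \<Rightarrow> int" where
  "r_elem p \<alpha> s =
    (if length s = 1 then [p] \<cdot>\<^bsub>P'_mod p \<alpha>\<^esub> e_basis p \<alpha> s
     else ([p] \<cdot>\<^bsub>P'_mod p \<alpha>\<^esub> e_basis p \<alpha> s) \<ominus>\<^bsub>P'_mod p \<alpha>\<^esub> e_basis p \<alpha> (tl s))"

definition submodule_generated ::
  "('a, 'm) ring_scheme \<Rightarrow> ('a, 'b, 'n) module_scheme \<Rightarrow> 'b set \<Rightarrow> 'b set" where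
  "submodule_generated R M B = \<Inter>{H. submodule H R M \<and> B \<subseteq> H}"

definition R_sub :: "nat \<Rightarrow> 'o::wellorder \<Rightarrow> ('o list \<Rightarrow> nat \<Rightarrow> int) set" where
  "R_sub p \<alpha> = submodule_generated (Zp p) (P'_mod p \<alpha>) (r_elem p \<alpha> ` diamond \<alpha>)"

definition D_grp :: "nat \<Rightarrow> 'o::wellorder \<Rightarrow> ('o list \<Rightarrow> nat \<Rightarrow> int) set monoid" where
  "D_grp p \<alpha> = add_monoid (P_mod p \<alpha>) Mod R_sub p \<alpha>"

definition E_grp :: "nat \<Rightarrow> 'o::wellorder \<Rightarrow> ('o list \<Rightarrow> nat \<Rightarrow> int) set set monoid" where
  "E_grp p \<alpha> = D_grp p \<alpha> Mod p_pow p (D_grp p \<alpha>) \<alpha>"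

end

theory Submission
  imports Defs "HOL-Library.Sublist"
begin

text \<open>
  The kernel of \<open>1 - F\<close> on \<open>S(E\<^sub>\<alpha>)\<close> consists of sequences with \<open>x\<^sub>i = p x\<^bsub>i+1\<^esub>\<close>, whose entries lie in
  \<open>p\<^sup>\<alpha>E\<^sub>\<alpha> = 0\<close>; and \<open>1 - F\<close> is surjective because \<open>E\<^sub>\<alpha>\<close> is a quotient of the \<open>p\<close>-complete group \<open>P\<^sub>\<alpha>\<close>.
  For the length, \<open>e\<^sub>\<beta>\<close> lies in \<open>p\<^sup>\<beta>D\<^sub>\<alpha>\<close>, since \<open>p e\<^bsub>\<gamma>\<sigma>\<^esub> = e\<^sub>\<sigma>\<close> in \<open>D\<^sub>\<alpha>\<close> for all \<open>\<gamma>\<close> below the head of \<open>\<sigma>\<close>. It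
  does not lie in \<open>p\<^bsup>\<beta>+1\<^esup>D\<^sub>\<alpha>\<close>: the additive functionals \<open>\<psi>\<^sub>\<sigma>(x) = \<Sum>\<^sub>\<omega> x\<^bsub>\<omega>\<sigma>\<^esub> / p\<^bsup>|\<omega>|+1\<^esup>\<close> from \<open>P'\<^sub>\<alpha>\<close> to
  \<open>\<rat>\<^sub>p/\<int>\<^sub>p\<close> annihilate \<open>R\<^sub>\<alpha>\<close> and satisfy \<open>\<psi>\<^sub>\<sigma>(p y) = \<Sum>\<^sub>\<delta> \<psi>\<^bsub>\<delta>\<sigma>\<^esub>(y)\<close>, so by induction on \<open>\<beta>\<close> those with the
  head of \<open>\<sigma>\<close> below \<open>\<beta>\<close> vanish on \<open>P'\<^sub>\<alpha> \<inter> p\<^sup>\<beta>D\<^sub>\<alpha>\<close> (no elements outside \<open>P'\<^sub>\<alpha>\<close> are needed, because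
  \<open>P\<^sub>\<alpha>/P'\<^sub>\<alpha>\<close> is torsion-free), whereas \<open>\<psi>\<^sub>\<beta>(e\<^sub>\<beta>) = 1/p\<close>.
\<close>


section \<open>Transfinite induction\<close>

text \<open>The cases match those of \<open>titer\<close>; the element \<open>a\<close> below
  \<open>b\<close> separates a limit from the least element, which satisfies closure under
  \<open>osuc\<close> vacuously.\<close>

lemma ordinal_induct [case_names zero succ limit]:
  fixes b :: "'o::{wellorder,no_top}"
  assumes zero: "\<And>b. (\<And>c. b \<le> c) \<Longrightarrow> Q b"
    and succ: "\<And>b. Q b \<Longrightarrow> Q (osuc b)"
    and limit: "\<And>a b. a < b \<Longrightarrow> (\<And>c. c < b \<Longrightarrow> osuc c < b) \<Longrightarrow> (\<And>c. c < b \<Longrightarrow> Q c) \<Longrightarrow> Q b"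
  shows "Q b"
proof (induction b rule: less_induct)
  case (less b)
  consider "\<forall>c. b \<le> c" | c where "b = osuc c" | a where "a < b" "\<forall>c<b. osuc c < b"
    by (metis not_le osuc_least order_le_less)
  then show ?case
  proof cases
    case 1
    then show ?thesis using zero by blast
  next
    case 2
    then show ?thesis using succ less osuc_greater by blast
  next
    case 3
    then show ?thesis using limit less by blast
  qed
qed

lemma less_osuc_iff: "c < osuc b \<longleftrightarrow> c \<le> (b::'o::{wellorder,no_top})"
  by (metis leD leI osuc_greater osuc_least order_le_less_trans)

section \<open>The transfinite \<open>p\<close>-filtration\<close>

lemma p_pow_zero: "(\<And>c. b \<le> c) \<Longrightarrow> p_pow p A b = carrier A"
  by (simp add: p_pow_def titer_zero)

lemma p_pow_osuc:
  fixes b :: "'o::{wellorder,no_top}"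
  shows "p_pow p A (osuc b) = (\<lambda>a. a [^]\<^bsub>A\<^esub> p) ` p_pow p A b"
  by (simp add: p_pow_def titer_osuc)

lemma p_pow_limit:
  fixes b :: "'o::{wellorder,no_top}"
  assumes "a < b" and "\<And>c. c < b \<Longrightarrow> osuc c < b"
  shows "p_pow p A b = (\<Inter>c\<in>{..<b}. p_pow p A c)"
  using assms by (simp add: p_pow_def titer_limit)

text \<open>All groups and bonds of \<open>mult_seq\<close> coincide, so the iterated images stay
  constant in the index; the length is thus decided by \<open>p_pow\<close> alone.\<close>

lemma titer_mult_seq:
  fixes b :: "'o::{wellorder,no_top}"
  shows "titer (image_step (mult_seq p A)) (\<lambda>i. carrier (grp (mult_seq p A) i)) b = (\<lambda>i. p_pow p A b)"
proof (induction b rule: ordinal_induct)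
  case (zero b)
  then show ?case by (simp add: p_pow_zero titer_zero mult_seq_def)
next
  case (succ b)
  then show ?case by (simp add: p_pow_osuc titer_osuc image_step_def) (simp add: mult_seq_def)
next
  case (limit a b)
  show ?case
    using limit(3) by (simp add: p_pow_limit[OF limit(1,2)] titer_limit[OF limit(1,2)] fun_eq_iff)
qed

lemma grp_I_pow_mult_seq:
  fixes b :: "'o::{wellorder,no_top}"
  shows "grp (I_pow (mult_seq p A) b) i = A\<lparr>carrier := p_pow p A b\<rparr>"
  unfolding I_pow_def titer_mult_seq by (simp add: mult_seq_def)

text \<open>Surjectivity of 1 - F for \<open>mult_seq p A\<close>, free of product groups and
  inverses so that it passes easily to quotients.\<close>

definition lim1_trivial :: "nat \<Rightarrow> ('a, 'b) monoid_scheme \<Rightarrow> bool" where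
  "lim1_trivial p A \<longleftrightarrow> (\<forall>a. (\<forall>i. a i \<in> carrier A) \<longrightarrow>
    (\<exists>x. \<forall>i::nat. x i \<in> carrier A \<and> x i = a i \<otimes>\<^bsub>A\<^esub> x (Suc i) [^]\<^bsub>A\<^esub> p))"

lemma (in normal) lim1_trivial_Mod:
  assumes "lim1_trivial p G"
  shows "lim1_trivial p (G Mod H)"
  unfolding lim1_trivial_def
proof (intro allI impI)
  fix a assume "\<forall>i::nat. a i \<in> carrier (G Mod H)"
  then have "\<forall>i. \<exists>b. b \<in> carrier G \<and> a i = H #> b"
    by (auto simp: carrier_FactGroup image_iff)
  then obtain b where b: "\<And>i. b i \<in> carrier G" "\<And>i. a i = H #> b i"
    by metis
  then obtain x where x: "\<And>i. x i \<in> carrier G" "\<And>i. x i = b i \<otimes> x (Suc i) [^] p"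
    using assms unfolding lim1_trivial_def by meson
  have "(H #> x i) = a i \<otimes>\<^bsub>G Mod H\<^esub> (H #> x (Suc i)) [^]\<^bsub>G Mod H\<^esub> p" for i
    using b[of i] x(1)[of "Suc i"] by (subst x(2)) (simp add: FactGroup_pow rcos_sum)
  moreover have "H #> x i \<in> carrier (G Mod H)" for i
    using x(1) by (auto simp: carrier_FactGroup)
  ultimately show "\<exists>x. \<forall>i. x i \<in> carrier (G Mod H) \<and> x i = a i \<otimes>\<^bsub>G Mod H\<^esub> x (Suc i) [^]\<^bsub>G Mod H\<^esub> p"
    by (intro exI[of _ "\<lambda>i. H #> x i"] allI conjI)
qed

text \<open>The filtration \<^const>\<open>p_pow\<close> is defined for bare \<^typ>\<open>'a monoid\<close> records only.\<close>

locale plain_comm_group = comm_group A for A :: "'a monoid" (structure)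
begin

lemma pow_hom: "(\<lambda>a. a [^] (n::nat)) \<in> hom A A"
  by (rule homI) (auto simp: pow_mult_distrib m_comm)

lemma p_pow_subgroup:
  fixes b :: "'o::{wellorder,no_top}"
  shows "subgroup (p_pow p A b) A"
proof (induction b rule: ordinal_induct)
  case (zero b)
  then show ?case by (simp add: p_pow_zero subgroup_self)
next
  case (succ b)
  interpret group_hom A A "\<lambda>a. a [^] p"
    by unfold_locales (rule pow_hom)
  show ?case
    unfolding p_pow_osuc using succ by (rule subgroup_img_is_subgroup)
next
  case (limit a b)
  have "subgroup (\<Inter>(p_pow p A ` {..<b})) A"
    using limit(1,3) by (intro subgroups_Inter) auto
  then show ?case by (simp add: p_pow_limit[OF limit(1,2)])
qed

lemma p_pow_antimono:
  fixes b c :: "'o::{wellorder,no_top}"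
  shows "b \<le> c \<Longrightarrow> p_pow p A c \<subseteq> p_pow p A b"
proof (induction c rule: ordinal_induct)
  case (zero c)
  then show ?case by (metis order_antisym order_refl)
next
  case (succ c)
  have "a [^] n \<in> p_pow p A c" if "a \<in> p_pow p A c" for a and n :: nat
    using subgroup.one_closed[OF p_pow_subgroup] subgroup.m_closed[OF p_pow_subgroup _ that]
    by (induction n) auto
  then have "p_pow p A (osuc c) \<subseteq> p_pow p A c"
    by (auto simp: p_pow_osuc)
  moreover have "b \<le> c" if "b \<noteq> osuc c"
    using succ.prems that less_osuc_iff order_le_less by metis
  ultimately show ?case
    using succ.IH by (cases "b = osuc c") auto
next
  case (limit a c)
  show ?case
    using limit(4) by (cases "b = c") (auto simp: p_pow_limit[OF limit(1,2)])
qed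

text \<open>Images need not commute with intersections; here they do at a limit, since
  \<open>N\<close> lies in every stage \<open>c < b \<le> a\<close>, so that any representative of a
  coset in the image of \<open>p_pow p A c\<close> is itself in \<open>p_pow p A c\<close>.\<close>

lemma p_pow_Mod:
  fixes p :: nat and a b :: "'o::{wellorder,no_top}"
  assumes "b \<le> a"
  defines "N \<equiv> p_pow p A a"
  shows "p_pow p (A Mod N) b = (\<lambda>x. N #> x) ` p_pow p A b"
  using assms(1)
proof (induction b rule: ordinal_induct)
  case (zero b)
  then show ?case by (simp add: p_pow_zero carrier_FactGroup)
next
  case (succ b)
  have N: "N \<lhd> A"
    by (simp add: N_def p_pow_subgroup normal_iff_subgroup)
  have "b \<le> a" "p_pow p A b \<subseteq> carrier A"
    using succ.prems osuc_greater[of b] subgroup.subset[OF p_pow_subgroup] by auto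
  then have "p_pow p (A Mod N) (osuc b) = (\<lambda>x. (N #> x) [^]\<^bsub>A Mod N\<^esub> p) ` p_pow p A b"
    using succ.IH by (simp add: p_pow_osuc image_image)
  also have "\<dots> = (\<lambda>x. N #> (x [^] p)) ` p_pow p A b"
    using \<open>p_pow p A b \<subseteq> carrier A\<close> by (intro image_cong) (auto simp: normal.FactGroup_pow[OF N])
  finally show ?case
    by (simp add: p_pow_osuc image_image)
next
  case (limit a' b)
  have sub: "p_pow p A c \<subseteq> carrier A" for c :: 'o
    using subgroup.subset[OF p_pow_subgroup] .
  have *: "Y \<in> (\<lambda>x. N #> x) ` p_pow p A b" if Y: "\<And>c. c < b \<Longrightarrow> Y \<in> (\<lambda>x. N #> x) ` p_pow p A c" for Y
  proof -
    \<comment> \<open>One representative is fixed, at the stage \<open>a'\<close> supplied by the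
      limit case; it then serves for all \<open>c < b\<close>.\<close>
    obtain x where "Y = N #> x" "x \<in> p_pow p A a'"
      using Y[OF limit(1)] by (rule imageE)
    then have x: "x \<in> carrier A" "Y = N #> x"
      using sub[of a'] by auto
    have "x \<in> p_pow p A c" if "c < b" for c
    proof -
      obtain y where y: "Y = N #> y" "y \<in> p_pow p A c"
        using Y[OF \<open>c < b\<close>] by (rule imageE)
      have "x \<in> N #> y"
        using x y rcos_self[OF _ p_pow_subgroup] N_def by metis
      moreover have "N \<subseteq> p_pow p A c"
        unfolding N_def using that limit.prems by (intro p_pow_antimono) auto
      ultimately show ?thesis
        using y(2) subgroup.m_closed[OF p_pow_subgroup, of _ p c] by (auto simp: r_coset_def)
    qed
    then show ?thesis
      using x by (auto simp: p_pow_limit[OF limit(1,2)])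
  qed
  have "p_pow p (A Mod N) b = (\<Inter>c\<in>{..<b}. (\<lambda>x. N #> x) ` p_pow p A c)"
    using limit(3,4) by (simp add: p_pow_limit[OF limit(1,2)])
  also have "\<dots> = (\<lambda>x. N #> x) ` p_pow p A b"
    using * by (auto simp: p_pow_limit[OF limit(1,2)])
  finally show ?case .
qed

section \<open>Length and locality of the sequence of multiplications by p\<close>

lemma mult_seq_invseq: "is_invseq (mult_seq p A)"
  by (simp add: is_invseq_def mult_seq_def pow_hom comm_group_axioms)

text \<open>The operations are inherited from \<open>A\<close>, so the identity is an isomorphism
  exactly when the two carriers coincide.\<close>

lemma stable_from_mult_seq:
  fixes m :: "'o::{wellorder,no_top}"
  shows "stable_from (mult_seq p A) m \<longleftrightarrow> (\<forall>b>m. p_pow p A b = p_pow p A m)"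
  by (auto simp: stable_from_def grp_I_pow_mult_seq iso_def bij_betw_def hom_def)

lemma has_len_mult_seq:
  fixes m :: "'o::{wellorder,no_top}"
  assumes "p_pow p A m = {\<one>}" and "\<And>b. b < m \<Longrightarrow> p_pow p A (osuc b) \<noteq> p_pow p A b"
  shows "has_len (mult_seq p A) m"
proof -
  have "p_pow p A b = p_pow p A m" if "b > m" for b :: 'o
    using p_pow_antimono[of m b p] that subgroup.one_closed[OF p_pow_subgroup] assms(1) by fastforce
  moreover have "m \<le> n" if "\<forall>b>n. p_pow p A b = p_pow p A n" for n
    using that assms(2) osuc_greater by (metis not_le)
  ultimately show ?thesis
    by (auto simp: has_len_def stable_from_mult_seq)
qed

text \<open>The index has to vary in the induction: at a successor, \<open>x i\<close> is p times
  \<open>x (Suc i)\<close>, to which the hypothesis applies.\<close>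

lemma divisible_in_p_pow:
  fixes b :: "'o::{wellorder,no_top}"
  assumes "\<And>i. x i \<in> carrier A" "\<And>i::nat. x i = x (Suc i) [^] p"
  shows "x i \<in> p_pow p A b"
proof (induction b arbitrary: i rule: ordinal_induct)
  case (zero b)
  then show ?case by (simp add: p_pow_zero assms(1))
next
  case (succ b)
  then show ?case unfolding p_pow_osuc using assms(2)[of i] by blast
next
  case (limit a b)
  show ?case using limit(3) by (auto simp: p_pow_limit[OF limit(1,2)])
qed

lemma is_local_mult_seq:
  fixes b :: "'o::{wellorder,no_top}"
  assumes p_pow: "p_pow p A b = {\<one>}" and lim1: "lim1_trivial p A"
  shows "is_local (mult_seq p A)"
proof -
  define S where "S = mult_seq p A"
  define Pr where "Pr = seq_prod S"
  have Pr_eq: "Pr = product_group UNIV (\<lambda>i. A)"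
    by (simp add: Pr_def seq_prod_def S_def mult_seq_def)
  have "group Pr" unfolding Pr_eq by simp
  have carrier: "x \<in> carrier Pr \<longleftrightarrow> (\<forall>i. x i \<in> carrier A)" for x
    by (auto simp: Pr_eq)
  have "comm_group Pr"
    using \<open>group Pr\<close> by (intro group.group_comm_groupI) (auto simp: Pr_eq PiE_iff m_comm intro!: restrict_ext)
  have h: "one_minus_shift S x = (\<lambda>i. x i \<otimes> inv (x (Suc i) [^] p))" if "x \<in> carrier Pr" for x
  proof -
    have "inv\<^bsub>Pr\<^esub> (shift_map S x) = (\<lambda>i. inv (x (Suc i) [^] p))"
      using that unfolding Pr_eq carrier[unfolded Pr_eq]
      by (subst inv_product_group) (auto simp: shift_map_def S_def mult_seq_def PiE_iff extensional_def)
    then show ?thesis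
      unfolding one_minus_shift_def by (simp flip: Pr_def) (simp add: Pr_eq restrict_def)
  qed
  have "one_minus_shift S \<in> hom Pr Pr"
  proof (rule homI)
    fix x y assume *: "x \<in> carrier Pr" "y \<in> carrier Pr"
    then have "x \<otimes>\<^bsub>Pr\<^esub> y \<in> carrier Pr"
      using \<open>group Pr\<close> by (simp add: group.is_monoid monoid.m_closed)
    moreover have "(x i \<otimes> y i) \<otimes> inv ((x (Suc i) \<otimes> y (Suc i)) [^] p)
        = (x i \<otimes> inv (x (Suc i) [^] p)) \<otimes> (y i \<otimes> inv (y (Suc i) [^] p))" for i
      using * by (simp add: carrier pow_mult_distrib inv_mult m_ac)
    ultimately show "one_minus_shift S (x \<otimes>\<^bsub>Pr\<^esub> y) = one_minus_shift S x \<otimes>\<^bsub>Pr\<^esub> one_minus_shift S y"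
      using * by (simp add: h) (simp add: Pr_eq restrict_def)
  next
    fix x assume "x \<in> carrier Pr"
    then show "one_minus_shift S x \<in> carrier Pr"
      by (simp add: h) (simp add: carrier)
  qed
  then interpret h: group_hom Pr Pr "one_minus_shift S"
    using \<open>group Pr\<close> by (simp add: group_hom_def group_hom_axioms_def)
  \<comment> \<open>The entries of a kernel element arise by successive divisions by p, so all lie
    in the trivial group \<open>p_pow p A b\<close>.\<close>
  have kernel: "x = \<one>\<^bsub>Pr\<^esub>" if "x \<in> kernel Pr Pr (one_minus_shift S)" for x
  proof -
    have x: "\<And>i. x i \<in> carrier A"
      using that by (auto simp: kernel_def carrier)
    have "(\<lambda>i. x i \<otimes> inv (x (Suc i) [^] p)) = \<one>\<^bsub>Pr\<^esub>"
      using that h by (auto simp: kernel_def)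
    then have "x i \<otimes> inv (x (Suc i) [^] p) = \<one>" for i
      by (simp add: Pr_eq fun_eq_iff)
    then have "x i = x (Suc i) [^] p" for i
      using inv_equality[of "x i" "inv (x (Suc i) [^] p)"] x by simp
    then have "x i \<in> p_pow p A b" for i
      using x by (intro divisible_in_p_pow)
    then have "x i = \<one>" for i
      by (simp add: p_pow)
    then show ?thesis
      by (simp add: Pr_eq fun_eq_iff)
  qed
  then have "kernel Pr Pr (one_minus_shift S) = {\<one>\<^bsub>Pr\<^esub>}"
    using subgroup.one_closed[OF h.subgroup_kernel] by blast
  then have "trivial_group (lim_group S)"
    unfolding lim_group_def trivial_group_def Pr_def[symmetric]
    using h.G.subgroup_imp_group[OF h.subgroup_kernel] by simp
  moreover have "one_minus_shift S ` carrier Pr = carrier Pr"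
  proof
    show "carrier Pr \<subseteq> one_minus_shift S ` carrier Pr"
    proof
      fix a assume a: "a \<in> carrier Pr"
      then obtain x where x: "\<And>i. x i \<in> carrier A" "\<And>i. x i = a i \<otimes> x (Suc i) [^] p"
        using lim1 unfolding lim1_trivial_def carrier by meson
      then have "a i = x i \<otimes> inv (x (Suc i) [^] p)" for i
        using a by (metis carrier inv_solve_right nat_pow_closed)
      then have "a = one_minus_shift S x"
        using x(1) by (subst h) (auto simp: carrier)
      then show "a \<in> one_minus_shift S ` carrier Pr"
        using x(1) by (auto simp: carrier)
    qed
  qed (use h.hom_closed in blast)
  moreover have "trivial_group (Pr Mod carrier Pr)"
    unfolding trivial_group_def
  proof
    show "Group.group (Pr Mod carrier Pr)"
      using comm_group.normal_iff_subgroup[OF \<open>comm_group Pr\<close>] h.G.subgroup_self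
      by (blast intro: normal.factorgroup_is_group)
    have "carrier Pr #>\<^bsub>Pr\<^esub> x = carrier Pr" if "x \<in> carrier Pr" for x
      using that by (intro h.G.coset_join2 h.G.subgroup_self)
    then show "carrier (Pr Mod carrier Pr) = {\<one>\<^bsub>Pr Mod carrier Pr\<^esub>}"
      using h.G.one_closed by (auto simp: carrier_FactGroup)
  qed
  ultimately show ?thesis
    by (simp add: is_local_def lim1_group_def Pr_def S_def)
qed

end



section \<open>The module \<open>P\<close>\<close>

text \<open>By division with remainder, residues may serve as numerators when fractions are
  considered modulo the integers.\<close>

lemma of_int_mod_divide:
  "real_of_int (a mod m) / of_int m = of_int a / of_int m - of_int (a div m)" if "m \<noteq> 0"
proof -
  have "real_of_int a = of_int m * of_int (a div m) + of_int (a mod m)"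
    by (simp flip: of_int_mult of_int_add)
  then show ?thesis
    using that by (simp add: field_simps)
qed

locale tree_presentation =
  fixes p :: nat and \<alpha> :: "'o::{wellorder,no_top}"
  assumes prime: "Factorial_Ring.prime p"
begin

definition "P = add_monoid (P_mod p \<alpha>)"

abbreviation "P' \<equiv> carrier (P'_mod p \<alpha>)"
abbreviation "R \<equiv> R_sub p \<alpha>"
abbreviation "D \<equiv> D_grp p \<alpha>"
abbreviation "e \<equiv> e_basis p \<alpha>"

lemma p_gt_1: "p > 1"
  using prime by (rule prime_gt_1_nat)

lemma ppow_gt_0: "int p ^ n > 0"
  using p_gt_1 by simp

lemma Zp_iff: "x \<in> carrier (Zp p) \<longleftrightarrow> (\<forall>n. 0 \<le> x n \<and> x n < int p ^ n \<and> x (Suc n) mod int p ^ n = x n)"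
  by (auto simp: Zp_def)

lemma Zp_mod: "m \<le> n \<Longrightarrow> x \<in> carrier (Zp p) \<Longrightarrow> x n mod int p ^ m = x m"
proof (induction n rule: dec_induct)
  case base
  then show ?case by (simp add: Zp_iff)
next
  case (step n)
  have "x (Suc n) mod int p ^ m = x (Suc n) mod int p ^ n mod int p ^ m"
    using step.hyps by (simp add: mod_mod_cancel le_imp_power_dvd)
  then show ?case
    using step by (simp add: Zp_iff)
qed

lemma Zp_0: "x \<in> carrier (Zp p) \<Longrightarrow> x 0 = 0"
  using Zp_iff[of x] by (metis power_0 int_one_le_iff_zero_less linorder_not_less order_antisym_conv)

lemma Zp_modI:
  assumes "\<And>n. f (Suc n) mod int p ^ n = f n mod int p ^ n"
  shows "(\<lambda>n. f n mod int p ^ n) \<in> carrier (Zp p)"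
  using assms ppow_gt_0 by (simp add: Zp_iff mod_mod_cancel le_imp_power_dvd)

lemma P_iff: "x \<in> carrier P \<longleftrightarrow> x \<in> extensional (diamond \<alpha>) \<and> (\<forall>s\<in>diamond \<alpha>. x s \<in> carrier (Zp p))"
  by (auto simp: P_def P_mod_def PiE_iff)

lemma P_mult: "x \<otimes>\<^bsub>P\<^esub> y = (\<lambda>s\<in>diamond \<alpha>. \<lambda>n. (x s n + y s n) mod int p ^ n)"
  by (simp add: P_def P_mod_def Zp_def)

lemma P_one: "\<one>\<^bsub>P\<^esub> = (\<lambda>s\<in>diamond \<alpha>. \<lambda>n. 0)"
  by (simp add: P_def P_mod_def Zp_def)

lemma P_smult: "c \<odot>\<^bsub>P'_mod p \<alpha>\<^esub> x = (\<lambda>s\<in>diamond \<alpha>. \<lambda>n. (c n * x s n) mod int p ^ n)"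
  by (simp add: P'_mod_def P_mod_def Zp_def)

lemma P_eqI:
  "x \<in> carrier P \<Longrightarrow> y \<in> carrier P \<Longrightarrow> (\<And>s n. s \<in> diamond \<alpha> \<Longrightarrow> x s n = y s n) \<Longrightarrow> x = y"
  unfolding P_iff by (blast intro: extensionalityI ext)

lemma P_Zp: "x \<in> carrier P \<Longrightarrow> s \<in> diamond \<alpha> \<Longrightarrow> x s \<in> carrier (Zp p)"
  by (simp add: P_iff)

lemma P_mod_same [simp]:
  assumes "x \<in> carrier P" "s \<in> diamond \<alpha>"
  shows "x s n mod int p ^ n = x s n" "x s (Suc n) mod int p ^ n = x s n"
  using assms by (simp_all add: P_iff Zp_iff)

lemma P_modI:
  assumes "\<And>s n. s \<in> diamond \<alpha> \<Longrightarrow> f s (Suc n) mod int p ^ n = f s n mod int p ^ n"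
  shows "(\<lambda>s\<in>diamond \<alpha>. \<lambda>n. f s n mod int p ^ n) \<in> carrier P"
  unfolding P_iff by (auto intro!: Zp_modI assms)

text \<open>Covers sums (\<open>c = d = 1\<close>) and negatives (\<open>c = -1\<close>,
  \<open>d = 0\<close>) at once.\<close>

lemma P_linear_closed:
  assumes "x \<in> carrier P" "y \<in> carrier P"
  shows "(\<lambda>s\<in>diamond \<alpha>. \<lambda>n. (c * x s n + d * y s n) mod int p ^ n) \<in> carrier P"
proof (rule P_modI)
  fix s :: "'o list" and n assume s: "s \<in> diamond \<alpha>"
  have "(c * x s (Suc n) + d * y s (Suc n)) mod int p ^ n
      = (c * (x s (Suc n) mod int p ^ n) + d * (y s (Suc n) mod int p ^ n)) mod int p ^ n"
    by (intro mod_add_cong mod_mult_cong) simp_all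
  then show "(c * x s (Suc n) + d * y s (Suc n)) mod int p ^ n = (c * x s n + d * y s n) mod int p ^ n"
    unfolding P_mod_same(2)[OF assms(1) s] P_mod_same(2)[OF assms(2) s] .
qed

lemma P_mult_closed: "x \<in> carrier P \<Longrightarrow> y \<in> carrier P \<Longrightarrow> x \<otimes>\<^bsub>P\<^esub> y \<in> carrier P"
  unfolding P_mult using P_linear_closed[of x y 1 1] by simp

lemma P_neg_closed: "x \<in> carrier P \<Longrightarrow> (\<lambda>s\<in>diamond \<alpha>. \<lambda>n. (- x s n) mod int p ^ n) \<in> carrier P"
  using P_linear_closed[of x x "-1" 0] by simp

lemma P_one_closed: "\<one>\<^bsub>P\<^esub> \<in> carrier P"
  unfolding P_one using ppow_gt_0 by (simp add: P_iff Zp_iff)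

lemma P_neg: "x \<in> carrier P \<Longrightarrow> (\<lambda>s\<in>diamond \<alpha>. \<lambda>n. (- x s n) mod int p ^ n) \<otimes>\<^bsub>P\<^esub> x = \<one>\<^bsub>P\<^esub>"
  by (rule P_eqI[OF P_mult_closed[OF P_neg_closed] P_one_closed]) (simp_all add: P_mult P_one mod_simps)

sublocale P: comm_group P
proof (rule comm_groupI)
  show "x \<otimes>\<^bsub>P\<^esub> y \<otimes>\<^bsub>P\<^esub> z = x \<otimes>\<^bsub>P\<^esub> (y \<otimes>\<^bsub>P\<^esub> z)"
    if "x \<in> carrier P" "y \<in> carrier P" "z \<in> carrier P" for x y z
    unfolding P_mult by (auto simp: mod_simps add.assoc intro!: restrict_ext)
  show "x \<otimes>\<^bsub>P\<^esub> y = y \<otimes>\<^bsub>P\<^esub> x" for x y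
    by (simp add: P_mult add.commute)
  show "\<one>\<^bsub>P\<^esub> \<otimes>\<^bsub>P\<^esub> x = x" if "x \<in> carrier P" for x
    using that by (intro P_eqI P_mult_closed P_one_closed) (simp_all add: P_mult P_one)
  show "\<exists>y\<in>carrier P. y \<otimes>\<^bsub>P\<^esub> x = \<one>\<^bsub>P\<^esub>" if "x \<in> carrier P" for x
    using P_neg[OF that] P_neg_closed[OF that] by blast
qed (use P_mult_closed P_one_closed in blast)+

lemma P_inv: "x \<in> carrier P \<Longrightarrow> inv\<^bsub>P\<^esub> x = (\<lambda>s\<in>diamond \<alpha>. \<lambda>n. (- x s n) mod int p ^ n)"
  by (rule P.inv_equality[OF P_neg]) (use P_neg_closed in auto)

lemma P_pow: "x \<in> carrier P \<Longrightarrow> x [^]\<^bsub>P\<^esub> m = (\<lambda>s\<in>diamond \<alpha>. \<lambda>n. (int m * x s n) mod int p ^ n)"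
proof (induction m)
  case 0
  then show ?case by (simp add: P_one)
next
  case (Suc m)
  then show ?case
    by (auto simp: P_mult mod_simps algebra_simps intro!: restrict_ext)
qed

text \<open>The solution of \<open>x i = a i + p \<cdot> x (i + 1)\<close> is \<open>x i = \<Sum>j. p\<^sup>j \<cdot> a (i + j)\<close>.\<close>

lemma P_lim1_trivial: "lim1_trivial p P"
  unfolding lim1_trivial_def
proof (intro allI impI)
  fix a assume a: "\<forall>i::nat. a i \<in> carrier P"
  \<comment> \<open>The series is cut off at \<open>n\<close> because its later terms vanish modulo
    p^n.\<close>
  define f where "f i s n = (\<Sum>j<n. int p ^ j * a (i + j) s n)" for i s n
  define x where "x i = (\<lambda>s\<in>diamond \<alpha>. \<lambda>n. f i s n mod int p ^ n)" for i
  have x: "x i \<in> carrier P" for i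
    unfolding x_def
  proof (rule P_modI)
    fix s :: "'o list" and n assume s: "s \<in> diamond \<alpha>"
    have "f i s (Suc n) mod int p ^ n = (\<Sum>j<n. int p ^ j * a (i + j) s (Suc n)) mod int p ^ n"
      by (simp add: f_def)
    also have "\<dots> = (\<Sum>j<n. int p ^ j * (a (i + j) s (Suc n) mod int p ^ n) mod int p ^ n) mod int p ^ n"
      by (simp only: mod_simps mod_sum_eq)
    also have "\<dots> = f i s n mod int p ^ n"
      using a s by (simp add: f_def mod_sum_eq)
    finally show "f i s (Suc n) mod int p ^ n = f i s n mod int p ^ n" .
  qed
  have "x i = a i \<otimes>\<^bsub>P\<^esub> x (Suc i) [^]\<^bsub>P\<^esub> p" for i
  proof (rule P_eqI)
    fix s :: "'o list" and n assume s: "s \<in> diamond \<alpha>"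
    \<comment> \<open>The added term j = n vanishes modulo p^n; splitting off j = 0 then leaves
      exactly the \<open>n\<close> terms of \<open>f (Suc i) s n\<close>.\<close>
    have "f i s n mod int p ^ n = (\<Sum>j<Suc n. int p ^ j * a (i + j) s n) mod int p ^ n"
      by (simp add: f_def)
    also have "(\<Sum>j<Suc n. int p ^ j * a (i + j) s n) = a i s n + int p * f (Suc i) s n"
      unfolding sum.lessThan_Suc_shift by (simp add: f_def sum_distrib_left mult_ac)
    finally show "x i s n = (a i \<otimes>\<^bsub>P\<^esub> x (Suc i) [^]\<^bsub>P\<^esub> p) s n"
      using s x[of "Suc i"] by (simp add: P_mult P_pow) (simp add: x_def mod_simps)
  qed (use a x in auto)
  then show "\<exists>x. \<forall>i. x i \<in> carrier P \<and> x i = a i \<otimes>\<^bsub>P\<^esub> x (Suc i) [^]\<^bsub>P\<^esub> p"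
    using x by blast
qed


section \<open>The submodules \<open>P'\<close> and \<open>R\<close>\<close>

definition supp :: "('o list \<Rightarrow> nat \<Rightarrow> int) \<Rightarrow> 'o list set" where
  "supp x = {s \<in> diamond \<alpha>. x s \<noteq> (\<lambda>n. 0)}"

lemma P'_iff: "x \<in> P' \<longleftrightarrow> x \<in> carrier P \<and> finite (supp x)"
  by (simp add: P_def P'_mod_def supp_def Zp_def)

lemma not_supp: "s \<in> diamond \<alpha> \<Longrightarrow> s \<notin> supp x \<Longrightarrow> x s n = 0"
  by (auto simp: supp_def)

lemma supp_subset: "supp x \<subseteq> diamond \<alpha>"
  by (auto simp: supp_def)

lemma add_monoid_P': "add_monoid (P'_mod p \<alpha>) = P\<lparr>carrier := P'\<rparr>"
  by (simp add: P_def P'_mod_def)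

lemma P'_subgroup: "subgroup P' P"
proof (rule P.subgroupI)
  show "P' \<subseteq> carrier P"
    by (auto simp: P'_iff)
  have "supp \<one>\<^bsub>P\<^esub> = {}"
    by (auto simp: supp_def P_one)
  then show "P' \<noteq> {}"
    by (metis P'_iff P.one_closed empty_iff finite.emptyI)
  show "inv\<^bsub>P\<^esub> x \<in> P'" if "x \<in> P'" for x
  proof -
    have "supp (inv\<^bsub>P\<^esub> x) \<subseteq> supp x"
      using that by (auto simp: P'_iff supp_def P_inv)
    then show ?thesis
      using that by (auto simp: P'_iff intro: finite_subset)
  qed
  show "x \<otimes>\<^bsub>P\<^esub> y \<in> P'" if "x \<in> P'" "y \<in> P'" for x y
  proof -
    have "supp (x \<otimes>\<^bsub>P\<^esub> y) \<subseteq> supp x \<union> supp y"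
      by (auto simp: supp_def P_mult)
    then show ?thesis
      using that by (auto simp: P'_iff intro: finite_subset)
  qed
qed

lemma P'_smult_closed: "c \<odot>\<^bsub>P'_mod p \<alpha>\<^esub> x \<in> P'" if c: "c \<in> carrier (Zp p)" and x: "x \<in> P'"
proof -
  have "c \<odot>\<^bsub>P'_mod p \<alpha>\<^esub> x \<in> carrier P"
    unfolding P_smult
  proof (rule P_modI)
    fix s :: "'o list" and n assume s: "s \<in> diamond \<alpha>"
    have "(c (Suc n) * x s (Suc n)) mod int p ^ n = (c (Suc n) mod int p ^ n * (x s (Suc n) mod int p ^ n)) mod int p ^ n"
      by (simp only: mod_simps)
    then show "(c (Suc n) * x s (Suc n)) mod int p ^ n = (c n * x s n) mod int p ^ n"
      using c x s by (simp add: P'_iff Zp_iff)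
  qed
  moreover have "supp (c \<odot>\<^bsub>P'_mod p \<alpha>\<^esub> x) \<subseteq> supp x"
    by (auto simp: supp_def P_smult)
  ultimately show ?thesis
    using x by (auto simp: P'_iff intro: finite_subset)
qed

lemma submodule_P'I:
  assumes "subgroup K P" "K \<subseteq> P'"
    and "\<And>c x. c \<in> carrier (Zp p) \<Longrightarrow> x \<in> K \<Longrightarrow> c \<odot>\<^bsub>P'_mod p \<alpha>\<^esub> x \<in> K"
  shows "submodule K (Zp p) (P'_mod p \<alpha>)"
  using assms P'_subgroup
  by (simp add: submodule_def submodule_axioms_def add_monoid_P' P.subgroup_incl)

lemma e_carrier: "e s \<in> P'"
proof -
  have "1 mod int p ^ Suc n mod int p ^ n = 1 mod int p ^ n" for n
    by (simp add: mod_mod_cancel)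
  then have "e s \<in> carrier P"
    using ppow_gt_0 by (auto simp: P_iff e_basis_def Zp_def)
  moreover have "supp (e s) \<subseteq> {s}"
    by (auto simp: supp_def e_basis_def Zp_def)
  ultimately show ?thesis
    by (auto simp: P'_iff intro: finite_subset)
qed

lemma e_P: "e s \<in> carrier P"
  using e_carrier P'_iff by blast

text \<open>Multiples and inverses formed inside the subgroup \<open>P'\<close> agree with those of
  \<open>P\<close>, where the later computations take place.\<close>

lemma r_elem_eq:
  "r_elem p \<alpha> s = (if length s = 1 then e s [^]\<^bsub>P\<^esub> p else e s [^]\<^bsub>P\<^esub> p \<otimes>\<^bsub>P\<^esub> inv\<^bsub>P\<^esub> (e (tl s)))"
proof -
  have pow: "[p] \<cdot>\<^bsub>P'_mod p \<alpha>\<^esub> x = x [^]\<^bsub>P\<^esub> p" for x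
    unfolding add_pow_def add_monoid_P' by (rule P.nat_pow_consistent[symmetric])
  have inv: "\<ominus>\<^bsub>P'_mod p \<alpha>\<^esub> x = inv\<^bsub>P\<^esub> x" if "x \<in> P'" for x
    unfolding a_inv_def add_monoid_P' by (rule P.m_inv_consistent[OF P'_subgroup that])
  have add: "x \<oplus>\<^bsub>P'_mod p \<alpha>\<^esub> y = x \<otimes>\<^bsub>P\<^esub> y" for x y
    by (simp add: P_def P'_mod_def)
  show ?thesis
    by (simp add: r_elem_def a_minus_def pow inv[OF e_carrier] add)
qed

lemma r_elem_P': "r_elem p \<alpha> s \<in> P'"
proof -
  have "e s [^]\<^bsub>P\<^esub> n \<in> P'" for n :: nat
    using e_carrier subgroup.one_closed[OF P'_subgroup] subgroup.m_closed[OF P'_subgroup]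
    by (induction n) auto
  then show ?thesis
    unfolding r_elem_eq
    using e_carrier subgroup.m_inv_closed[OF P'_subgroup] subgroup.m_closed[OF P'_subgroup] by auto
qed

lemma R_subset:
  assumes "subgroup K P" "K \<subseteq> P'"
    and "\<And>c x. c \<in> carrier (Zp p) \<Longrightarrow> x \<in> K \<Longrightarrow> c \<odot>\<^bsub>P'_mod p \<alpha>\<^esub> x \<in> K"
    and "\<And>s. s \<in> diamond \<alpha> \<Longrightarrow> r_elem p \<alpha> s \<in> K"
  shows "R \<subseteq> K"
  unfolding R_sub_def submodule_generated_def using submodule_P'I[OF assms(1-3)] assms(4) by auto

lemma r_elem_R: "s \<in> diamond \<alpha> \<Longrightarrow> r_elem p \<alpha> s \<in> R"
  unfolding R_sub_def submodule_generated_def by auto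

lemma R_subset_P': "R \<subseteq> P'"
  using R_subset P'_subgroup P'_smult_closed r_elem_P' by blast

lemma R_subgroup: "subgroup R P"
proof -
  \<comment> \<open>\<open>P'\<close> itself contains the generators, so the intersection defining
    \<open>R\<close> is not over the empty family.\<close>
  have "submodule P' (Zp p) (P'_mod p \<alpha>)"
    by (rule submodule_P'I) (use P'_subgroup P'_smult_closed in auto)
  then have "subgroup R (P\<lparr>carrier := P'\<rparr>)"
    unfolding R_sub_def submodule_generated_def add_monoid_P'[symmetric]
    using r_elem_P' by (intro group.subgroups_Inter[OF P.subgroup_imp_group[OF P'_subgroup], folded add_monoid_P']) (auto simp: submodule_def)
  then show ?thesis
    by (rule P.incl_subgroup[OF P'_subgroup])
qed

lemma R_normal: "R \<lhd> P"
  using R_subgroup P.normal_iff_subgroup by blast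

sublocale D: plain_comm_group D
  unfolding plain_comm_group_def D_grp_def P_def[symmetric] using R_subgroup by (rule P.abelian_FactGroup)


section \<open>A filtration of \<open>P'\<close>\<close>

text \<open>For t = \<omega>s the index read is |\<omega>| + 1, where the entry is the residue of
  \<open>x t\<close> modulo the denominator; the quotient represents x_t / p^(|\<omega>|+1) modulo
  the integers.\<close>

definition wt :: "'o list \<Rightarrow> ('o list \<Rightarrow> nat \<Rightarrow> int) \<Rightarrow> 'o list \<Rightarrow> real" where
  "wt s x t = of_int (x t (Suc (length t - length s))) / of_int (int p ^ Suc (length t - length s))"

text \<open>
  Modulo \<open>\<int>\<close>, this is \<open>\<Sum>\<^sub>\<omega> x\<^bsub>\<omega>s\<^esub> / p\<^bsup>|\<omega>| + 1\<^esup> \<in> \<rat>\<^sub>p / \<int>\<^sub>p\<close>, where \<open>\<omega>\<close> runs through the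
  finite sequences with \<open>\<omega>s\<close> increasing. It is additive in \<open>x\<close> and annihilates the relations.
\<close>

definition psi :: "'o list \<Rightarrow> ('o list \<Rightarrow> nat \<Rightarrow> int) \<Rightarrow> real" where
  "psi s x = (\<Sum>t | t \<in> supp x \<and> suffix s t. wt s x t)"

text \<open>Serves as an upper bound for the elements of \<open>P'\<close> whose class lies in
  \<open>p_pow p D b\<close>.\<close>

definition Q :: "'o \<Rightarrow> ('o list \<Rightarrow> nat \<Rightarrow> int) set" where
  "Q b = {x \<in> P'. \<forall>s\<in>diamond \<alpha>. hd s < b \<longrightarrow> psi s x \<in> \<int>}"

text \<open>Points outside the support contribute 0, so elements with different supports can be
  compared over one index set.\<close>

lemma psi_eq:
  assumes "finite F" "supp x \<subseteq> F" "F \<subseteq> diamond \<alpha>"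
  shows "psi s x = (\<Sum>t | t \<in> F \<and> suffix s t. wt s x t)"
  unfolding psi_def
proof (rule sum.mono_neutral_left)
  show "\<forall>t\<in>{t. t \<in> F \<and> suffix s t} - {t. t \<in> supp x \<and> suffix s t}. wt s x t = 0"
    using assms(3) by (auto simp: wt_def not_supp)
qed (use assms in auto)

text \<open>No \<open>wt s\<close> reads beyond index \<open>Suc (length t)\<close>, so congruences
  up to there suffice; each reduction changes a term by an integer.\<close>

lemma psi_linear:
  assumes F: "finite F" "F \<subseteq> diamond \<alpha>" "supp x \<subseteq> F" "supp y \<subseteq> F" "supp z \<subseteq> F"
    and z: "\<And>t n. t \<in> F \<Longrightarrow> n \<le> Suc (length t) \<Longrightarrow> z t n = (c * x t n + d * y t n) mod int p ^ n"
  shows "psi s z - (of_int c * psi s x + of_int d * psi s y) \<in> \<int>"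
proof -
  let ?F = "{t. t \<in> F \<and> suffix s t}"
  have "wt s z t - (of_int c * wt s x t + of_int d * wt s y t) \<in> \<int>" if "t \<in> F" for t
  proof -
    define k where "k = Suc (length t - length s)"
    define m where "m = int p ^ k"
    have wt: "wt s u t = of_int (u t k) / of_int m" for u
      by (simp only: wt_def k_def m_def)
    have "m \<noteq> 0"
      using p_gt_1 by (simp add: m_def)
    moreover have "z t k = (c * x t k + d * y t k) mod m"
      using z[OF that, of k] by (simp add: m_def k_def)
    ultimately show ?thesis
      by (simp add: wt of_int_mod_divide add_divide_distrib)
  qed
  then have "(\<Sum>t\<in>?F. wt s z t - (of_int c * wt s x t + of_int d * wt s y t)) \<in> \<int>"
    by (intro Ints_sum) auto
  also have "(\<Sum>t\<in>?F. wt s z t - (of_int c * wt s x t + of_int d * wt s y t))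
      = psi s z - (of_int c * psi s x + of_int d * psi s y)"
    using F by (simp add: psi_eq[of F] sum_subtractf sum.distrib sum_distrib_left)
  finally show ?thesis .
qed

lemma Q_linear:
  assumes "x \<in> Q b" "y \<in> Q b" "z \<in> P'"
    and z: "\<And>t n. t \<in> supp x \<union> supp y \<union> supp z \<Longrightarrow>
      n \<le> Suc (length t) \<Longrightarrow> z t n = (c * x t n + d * y t n) mod int p ^ n"
  shows "z \<in> Q b"
proof -
  have "psi s z \<in> \<int>" if s: "s \<in> diamond \<alpha>" "hd s < b" for s
  proof -
    have "psi s z - (of_int c * psi s x + of_int d * psi s y) \<in> \<int>"
      using assms by (intro psi_linear[of "supp x \<union> supp y \<union> supp z"]) (auto simp: Q_def P'_iff supp_def)
    moreover have "of_int c * psi s x + of_int d * psi s y \<in> \<int>"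
      using assms s by (intro Ints_add Ints_mult Ints_of_int) (auto simp: Q_def)
    ultimately show ?thesis
      by (metis Ints_add diff_add_cancel)
  qed
  with \<open>z \<in> P'\<close> show ?thesis
    by (simp add: Q_def)
qed

lemma Q_subset: "Q b \<subseteq> P'"
  by (auto simp: Q_def)

lemma Q_subgroup: "subgroup (Q b) P"
proof (rule P.subgroupI)
  show "Q b \<subseteq> carrier P"
    by (auto simp: Q_def P'_iff)
  have "supp \<one>\<^bsub>P\<^esub> = {}"
    by (auto simp: supp_def P_one)
  then have "\<one>\<^bsub>P\<^esub> \<in> Q b"
    using subgroup.one_closed[OF P'_subgroup] by (simp add: Q_def psi_def)
  then show "Q b \<noteq> {}"
    by blast
  show "inv\<^bsub>P\<^esub> x \<in> Q b" if x: "x \<in> Q b" for x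
  proof (rule Q_linear[OF x x])
    show "inv\<^bsub>P\<^esub> x \<in> P'"
      using x subgroup.m_inv_closed[OF P'_subgroup] by (simp add: Q_def)
    show "(inv\<^bsub>P\<^esub> x) t n = ((-1) * x t n + 0 * x t n) mod int p ^ n"
      if "t \<in> supp x \<union> supp x \<union> supp (inv\<^bsub>P\<^esub> x)" for t n
      using that x supp_subset by (auto simp: Q_def P'_iff P_inv subset_iff)
  qed
  show "x \<otimes>\<^bsub>P\<^esub> y \<in> Q b" if xy: "x \<in> Q b" "y \<in> Q b" for x y
  proof (rule Q_linear[OF xy])
    show "x \<otimes>\<^bsub>P\<^esub> y \<in> P'"
      using xy subgroup.m_closed[OF P'_subgroup] by (simp add: Q_def)
    show "(x \<otimes>\<^bsub>P\<^esub> y) t n = (1 * x t n + 1 * y t n) mod int p ^ n"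
      if "t \<in> supp x \<union> supp y \<union> supp (x \<otimes>\<^bsub>P\<^esub> y)" for t n
      using that supp_subset by (auto simp: P_mult subset_iff)
  qed
qed

text \<open>
  Only finitely many entries of \<open>x\<close> enter \<open>psi s x\<close>, so the scalar may be replaced by an integer.
\<close>

lemma Q_smult_closed:
  assumes c: "c \<in> carrier (Zp p)" and x: "x \<in> Q b"
  shows "c \<odot>\<^bsub>P'_mod p \<alpha>\<^esub> x \<in> Q b"
proof -
  let ?z = "c \<odot>\<^bsub>P'_mod p \<alpha>\<^esub> x"
  have fin: "finite (supp x)" and sub: "supp ?z \<subseteq> supp x"
    using x by (auto simp: Q_def P'_iff supp_def P_smult)
  \<comment> \<open>\<open>c N\<close> is the integer replacing \<open>c\<close>: \<open>N\<close>
    bounds all indices read on the support, and the inserted 0 covers an empty support.\<close>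
  define N where "N = Max (insert 0 ((\<lambda>t. Suc (length t)) ` supp x))"
  have N: "Suc (length t) \<le> N" if "t \<in> supp x" for t
    unfolding N_def using that fin by (intro Max_ge) auto
  show ?thesis
  proof (rule Q_linear[OF x x])
    show "?z \<in> P'"
      using c x by (intro P'_smult_closed) (auto simp: Q_def)
    show "?z t n = (c N * x t n + 0 * x t n) mod int p ^ n"
      if t: "t \<in> supp x \<union> supp x \<union> supp ?z" and n: "n \<le> Suc (length t)" for t n
    proof -
      have "t \<in> supp x" "n \<le> N"
        using sub t n N[of t] by auto
      then have "c n = c N mod int p ^ n"
        using Zp_mod[OF _ c] by simp
      then show ?thesis
        using \<open>t \<in> supp x\<close> supp_subset by (auto simp: P_smult mod_simps subset_iff)
    qed
  qed
qed

section \<open>The relations\<close>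

lemma e_value: "t \<in> diamond \<alpha> \<Longrightarrow> e s t n = (if t = s then 1 mod int p ^ n else 0)"
  by (simp add: e_basis_def Zp_def)

lemma psi_e:
  assumes "t \<in> diamond \<alpha>"
  shows "psi s (e t) = (if suffix s t then 1 / of_int (int p ^ Suc (length t - length s)) else 0)"
proof -
  have "psi s (e t) = (\<Sum>u | u \<in> {t} \<and> suffix s u. wt s (e t) u)"
    using assms by (intro psi_eq) (auto simp: supp_def e_value)
  also have "{u. u \<in> {t} \<and> suffix s u} = (if suffix s t then {t} else {})"
    by auto
  finally show ?thesis
    using assms p_gt_1 power_gt1[of "int p"] by (simp add: wt_def e_value)
qed

lemma diamond_Cons: "b # s \<in> diamond \<alpha> \<Longrightarrow> s \<noteq> [] \<Longrightarrow> s \<in> diamond \<alpha>"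
  by (auto simp: diamond_def)

text \<open>Every \<open>psi u\<close> is integral on relations, whatever \<open>b\<close>:
  multiplication by p compensates the additional factor 1/p in the value at \<open>e s\<close>
  compared with that at \<open>e (tl s)\<close>.\<close>

lemma r_elem_Q:
  assumes s: "s \<in> diamond \<alpha>"
  shows "r_elem p \<alpha> s \<in> Q b"
proof -
  have "psi u (r_elem p \<alpha> s) \<in> \<int>" if u: "u \<in> diamond \<alpha>" for u
  proof (cases "length s = 1")
    case True
    then obtain a where a: "s = [a]"
      by (auto simp: length_Suc_conv)
    have "psi u (r_elem p \<alpha> s) - (of_int (int p) * psi u (e s) + of_int 0 * psi u (e s)) \<in> \<int>"
      using s by (intro psi_linear[of "{s}"])
        (auto simp: r_elem_eq True e_P P_pow supp_def e_value split: if_splits)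
    moreover have "of_int (int p) * psi u (e s) \<in> \<int>"
      using s u p_gt_1 by (auto simp: psi_e a suffix_Cons diamond_def)
    ultimately show ?thesis
      by (metis Ints_add diff_add_cancel mult_zero_left add_0_right of_int_0)
  next
    case False
    then obtain a v where s_eq: "s = a # v" and "v \<noteq> []"
      using s by (cases s) (auto simp: diamond_def)
    then have v: "v \<in> diamond \<alpha>"
      using s diamond_Cons by blast
    have val: "r_elem p \<alpha> s t n = (int p * e s t n + (-1) * e v t n) mod int p ^ n" if "t \<in> diamond \<alpha>" for t n
      using that False by (simp add: r_elem_eq s_eq e_P P_pow P_mult P_inv mod_simps)
    have "supp (r_elem p \<alpha> s) \<subseteq> {s, v}" "supp (e s) \<subseteq> {s, v}" "supp (e v) \<subseteq> {s, v}"
      by (auto simp: supp_def val e_value)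
    then have "psi u (r_elem p \<alpha> s) - (of_int (int p) * psi u (e s) + of_int (-1) * psi u (e v)) \<in> \<int>"
      using s v by (intro psi_linear[of "{s, v}"] val) auto
    moreover have "of_int (int p) * psi u (e s) + of_int (-1) * psi u (e v) \<in> \<int>"
    proof (cases "u = s")
      case True
      \<comment> \<open>Here \<open>e s\<close> contributes p * 1/p = 1, and \<open>e v\<close>
        nothing, as \<open>v\<close> is shorter than \<open>u\<close>.\<close>
      then have "\<not> suffix u v"
        using suffix_length_le[of u v] by (auto simp: s_eq)
      then show ?thesis
        using True s v p_gt_1 by (simp add: psi_e)
    next
      case neq: False
      show ?thesis
      proof (cases "suffix u v")
        case True
        then have "length s - length u = Suc (length v - length u)"
          using suffix_length_le[of u v] by (simp add: s_eq)
        then show ?thesis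
          using True s v p_gt_1 by (simp add: psi_e s_eq suffix_ConsI)
      next
        case False
        then show ?thesis
          using neq s v by (simp add: psi_e s_eq suffix_Cons)
      qed
    qed
    ultimately show ?thesis
      by (metis Ints_add diff_add_cancel)
  qed
  then show ?thesis
    using r_elem_P' by (simp add: Q_def)
qed

lemma R_subset_Q: "R \<subseteq> Q b"
  using R_subset[OF Q_subgroup Q_subset Q_smult_closed r_elem_Q] .

section \<open>Multiplication by p\<close>

text \<open>Modulo p^(n+1), p times a number depends only on that number modulo p^n, and p times a
  reduced residue is again reduced.\<close>

lemma P_pow_entry:
  assumes "y \<in> carrier P" "t \<in> diamond \<alpha>"
  shows "(y [^]\<^bsub>P\<^esub> p) t (Suc n) = int p * y t n"
  using assms by (simp add: P_pow)

text \<open>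
  Here \<open>psi s (p \<cdot> y) = \<Sum>\<^sub>d psi (d # s) y\<close>, because the entry of \<open>p \<cdot> y\<^sub>t\<close> modulo \<open>p\<^bsup>k+1\<^esup>\<close> is
  \<open>p\<close> times the entry of \<open>y\<^sub>t\<close> modulo \<open>p\<^sup>k\<close>.
\<close>

lemma Q_pow:
  assumes y: "y \<in> Q b"
  shows "y [^]\<^bsub>P\<^esub> p \<in> Q (osuc b)"
proof -
  let ?z = "y [^]\<^bsub>P\<^esub> p"
  have yP: "y \<in> carrier P" and fin: "finite (supp y)"
    using y by (auto simp: Q_def P'_iff)
  have sub: "supp ?z \<subseteq> supp y"
    using yP by (auto simp: supp_def P_pow)
  have "psi s ?z \<in> \<int>" if s: "s \<in> diamond \<alpha>" "hd s < osuc b" for s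
  proof -
    define F where "F = {t \<in> supp y. strict_suffix s t}"
    \<comment> \<open>For a proper suffix \<open>s\<close> of \<open>t\<close>, this is the entry of
      \<open>t\<close> directly before \<open>s\<close>.\<close>
    define g where "g t = t ! (length t - length s - 1)" for t :: "'o list"
    have g: "suffix (d # s) t \<longleftrightarrow> strict_suffix s t \<and> g t = d" for d t
    proof (cases "suffix s t")
      case True
      then obtain u where t: "t = u @ s"
        by (auto simp: suffix_def)
      show ?thesis
      proof (cases u rule: rev_cases)
        case Nil
        then show ?thesis
          using suffix_length_le[of "d # s" s] by (auto simp: t)
      next
        case (snoc w c)
        have "suffix (d # s) t \<longleftrightarrow> (\<exists>v. (w @ [c]) @ s = (v @ [d]) @ s)"
          by (simp add: t snoc suffix_def)
        also have "\<dots> \<longleftrightarrow> c = d"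
          unfolding append_same_eq by auto
        finally show ?thesis
          by (auto simp: t snoc g_def nth_append strict_suffix_def suffix_def)
      qed
    qed (auto simp: strict_suffix_def dest: suffix_ConsD)
    have wt_eq: "wt s ?z t = of_int (y t (length t - length s)) / of_int (int p ^ (length t - length s))"
      if t: "t \<in> supp y" for t
    proof -
      let ?k = "length t - length s"
      have td: "t \<in> diamond \<alpha>"
        using t supp_subset by blast
      have "?z t (Suc ?k) = int p * y t ?k"
        using yP td by (rule P_pow_entry)
      then show ?thesis
        using p_gt_1 by (simp add: wt_def)
    qed
    have "psi s ?z = (\<Sum>t | t \<in> supp y \<and> suffix s t. wt s ?z t)"
      using fin sub supp_subset by (intro psi_eq)
    \<comment> \<open>By \<open>wt_eq\<close>, the omitted term \<open>t = s\<close> reads entry 0,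
      the residue modulo 1, which is 0.\<close>
    also have "\<dots> = (\<Sum>t\<in>F. wt s ?z t)"
    proof (rule sum.mono_neutral_right)
      show "\<forall>t\<in>{t. t \<in> supp y \<and> suffix s t} - F. wt s ?z t = 0"
        using yP supp_subset by (auto simp: F_def wt_eq strict_suffix_def Zp_0[OF P_Zp] subset_iff)
    qed (use fin in \<open>auto simp: F_def strict_suffix_def\<close>)
    also have "\<dots> = (\<Sum>d\<in>g ` F. \<Sum>t | t \<in> F \<and> g t = d. wt s ?z t)"
      using fin by (intro sum.group[symmetric]) (auto simp: F_def)
    also have "\<dots> = (\<Sum>d\<in>g ` F. psi (d # s) y)"
      unfolding psi_def
    proof (intro sum.cong refl)
      fix d
      show "{t. t \<in> F \<and> g t = d} = {t. t \<in> supp y \<and> suffix (d # s) t}"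
        by (auto simp: F_def g)
      fix t assume t: "t \<in> {t. t \<in> supp y \<and> suffix (d # s) t}"
      then have "Suc (length t - length (d # s)) = length t - length s"
        by (auto dest!: suffix_length_le)
      then show "wt s ?z t = wt (d # s) y t"
        using t wt_eq[of t] by (simp add: wt_def del: power_Suc)
    qed
    also have "\<dots> \<in> \<int>"
    proof (rule Ints_sum)
      \<comment> \<open>An entry \<open>d\<close> directly before \<open>s\<close> satisfies
        \<open>d < hd s \<le> b\<close>, so \<open>psi (d # s)\<close> is among the functionals
        controlled by \<open>y \<in> Q b\<close>.\<close>
      fix d assume "d \<in> g ` F"
      then obtain t where "t \<in> supp y" "suffix (d # s) t"
        by (auto simp: F_def g)
      then have "t \<in> diamond \<alpha>"
        using supp_subset by blast
      with \<open>suffix (d # s) t\<close> have ds: "d # s \<in> diamond \<alpha>"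
        by (auto simp: diamond_def suffix_def sorted_wrt_append)
      then have "d < hd s"
        using s by (cases s) (auto simp: diamond_def)
      then have "hd (d # s) < b"
        using s(2) by (simp add: less_osuc_iff)
      then show "psi (d # s) y \<in> \<int>"
        using ds y by (auto simp: Q_def)
    qed
    finally show ?thesis .
  qed
  moreover have "?z \<in> P'"
    using fin sub yP by (auto simp: P'_iff intro: finite_subset)
  ultimately show ?thesis
    by (simp add: Q_def)
qed

text \<open>A non-zero entry of \<open>y t\<close> at \<open>n\<close> yields a non-zero entry of
  its p-multiple at \<open>Suc n\<close>, so no support is lost: P/P' has no p-torsion.\<close>

lemma P'_pure:
  assumes "y \<in> carrier P" "y [^]\<^bsub>P\<^esub> p \<in> P'"
  shows "y \<in> P'"
proof -
  have "supp y \<subseteq> supp (y [^]\<^bsub>P\<^esub> p)"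
  proof
    fix t assume t: "t \<in> supp y"
    then have td: "t \<in> diamond \<alpha>" and "\<exists>n. y t n \<noteq> 0"
      by (auto simp: supp_def)
    then obtain n where n: "y t n \<noteq> 0"
      by blast
    have "(y [^]\<^bsub>P\<^esub> p) t (Suc n) = int p * y t n"
      using assms(1) td by (rule P_pow_entry)
    also have "\<dots> \<noteq> 0"
      using n p_gt_1 by simp
    finally show "t \<in> supp (y [^]\<^bsub>P\<^esub> p)"
      using td by (auto simp: supp_def)
  qed
  then show ?thesis
    using assms by (auto simp: P'_iff intro: finite_subset)
qed


section \<open>The \<open>p\<close>-filtrations of \<open>D\<close> and \<open>E\<close>\<close>

lemma D_eq: "D = P Mod R"
  by (simp add: D_grp_def P_def)

lemma coset_eqI: "r \<in> R \<Longrightarrow> x \<in> carrier P \<Longrightarrow> R #>\<^bsub>P\<^esub> (r \<otimes>\<^bsub>P\<^esub> x) = R #>\<^bsub>P\<^esub> x"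
  using R_subgroup by (intro P.repr_independence[symmetric]) (auto simp: r_coset_def)

lemma D_pow: "x \<in> carrier P \<Longrightarrow> (R #>\<^bsub>P\<^esub> x) [^]\<^bsub>D\<^esub> n = R #>\<^bsub>P\<^esub> (x [^]\<^bsub>P\<^esub> (n::nat))"
  unfolding D_eq by (rule normal.FactGroup_pow[OF R_normal])

text \<open>At a successor, x = r + p y with r in \<open>R\<close>; purity puts y into
  \<open>P'\<close>, where the induction hypothesis applies. At a limit, each \<open>psi s\<close>
  in question is already controlled at the stage \<open>osuc (hd s)\<close> below
  \<open>b\<close>.\<close>

lemma p_pow_D_imp_Q:
  assumes "x \<in> P'" "R #>\<^bsub>P\<^esub> x \<in> p_pow p D b"
  shows "x \<in> Q b"
  using assms
proof (induction b arbitrary: x rule: ordinal_induct)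
  case (zero b)
  have "\<not> c < b" for c
    using zero(1) by (simp add: not_less)
  then show ?case
    using zero.prems by (simp add: Q_def)
next
  case (succ b)
  obtain Y where Y: "Y \<in> p_pow p D b" "R #>\<^bsub>P\<^esub> x = Y [^]\<^bsub>D\<^esub> p"
    using succ.prems(2) unfolding p_pow_osuc by blast
  then have "Y \<in> carrier D"
    using subgroup.subset[OF D.p_pow_subgroup] by blast
  then obtain y where y: "y \<in> carrier P" "Y = R #>\<^bsub>P\<^esub> y"
    by (auto simp: D_eq carrier_FactGroup)
  have xP: "x \<in> carrier P"
    using succ.prems(1) by (simp add: P'_iff)
  have "x \<in> R #>\<^bsub>P\<^esub> (y [^]\<^bsub>P\<^esub> p)"
    using P.rcos_self[OF xP R_subgroup] Y(2) y by (simp add: D_pow)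
  then obtain r where r: "r \<in> R" "x = r \<otimes>\<^bsub>P\<^esub> y [^]\<^bsub>P\<^esub> p"
    by (auto simp: r_coset_def)
  have rP: "r \<in> carrier P"
    using r(1) R_subset_P' by (auto simp: P'_iff)
  have "y [^]\<^bsub>P\<^esub> p = inv\<^bsub>P\<^esub> r \<otimes>\<^bsub>P\<^esub> x"
    using r y rP xP by (simp add: P.inv_solve_left)
  then have "y [^]\<^bsub>P\<^esub> p \<in> P'"
    using r(1) R_subset_P' succ.prems(1) subgroup.m_closed[OF P'_subgroup] subgroup.m_inv_closed[OF P'_subgroup]
    by auto
  then have "y \<in> Q b"
    using succ.IH y Y P'_pure by blast
  then show ?case
    unfolding r(2) using r(1) R_subset_Q by (intro subgroup.m_closed[OF Q_subgroup] Q_pow) auto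
next
  case (limit a b)
  have "psi s x \<in> \<int>" if "s \<in> diamond \<alpha>" "hd s < b" for s
  proof -
    have "R #>\<^bsub>P\<^esub> x \<in> (\<Inter>c\<in>{..<b}. p_pow p D c)"
      using limit.prems(2) by (simp add: p_pow_limit[OF limit(1,2)])
    then have "R #>\<^bsub>P\<^esub> x \<in> p_pow p D (osuc (hd s))"
      using limit(2)[OF that(2)] by (meson INT_E lessThan_iff)
    then have "x \<in> Q (osuc (hd s))"
      using limit(2)[OF that(2)] limit(3) limit.prems(1) by blast
    then show ?thesis
      using that osuc_greater by (auto simp: Q_def)
  qed
  then show ?case
    using limit.prems(1) by (simp add: Q_def)
qed

text \<open>At a successor, \<open>e s\<close> is p times \<open>e (b # s)\<close> modulo
  \<open>R\<close>, and the hypothesis applies to \<open>b # s\<close>, whose head is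
  \<open>b\<close>.\<close>

lemma e_in_p_pow_D:
  assumes "s \<in> diamond \<alpha>" "b \<le> hd s"
  shows "R #>\<^bsub>P\<^esub> e s \<in> p_pow p D b"
  using assms
proof (induction b arbitrary: s rule: ordinal_induct)
  case (zero b)
  then show ?case by (auto simp: p_pow_zero D_eq carrier_FactGroup e_P)
next
  case (succ b)
  let ?t = "b # s"
  have "b < hd s" "s \<noteq> []"
    using succ.prems osuc_greater[of b] by (auto simp: diamond_def)
  then have t: "?t \<in> diamond \<alpha>"
    using succ.prems(1) by (cases s) (auto simp: diamond_def)
  have "e ?t [^]\<^bsub>P\<^esub> p = r_elem p \<alpha> ?t \<otimes>\<^bsub>P\<^esub> e s"
    using \<open>s \<noteq> []\<close> by (simp add: r_elem_eq e_P P.m_assoc)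
  then have "R #>\<^bsub>P\<^esub> e s = (R #>\<^bsub>P\<^esub> e ?t) [^]\<^bsub>D\<^esub> p"
    using t by (simp add: D_pow e_P coset_eqI r_elem_R)
  then show ?case
    unfolding p_pow_osuc using succ.IH[OF t] by auto
next
  case (limit a b)
  have "R #>\<^bsub>P\<^esub> e s \<in> p_pow p D c" if "c < b" for c
    using limit(3)[OF that] limit.prems that by auto
  then show ?case
    by (simp add: p_pow_limit[OF limit(1,2)])
qed

lemma e_not_in_p_pow_D:
  assumes "b < \<alpha>"
  shows "R #>\<^bsub>P\<^esub> e [b] \<notin> p_pow p D (osuc b)"
proof
  have b: "[b] \<in> diamond \<alpha>"
    using assms by (simp add: diamond_def)
  assume "R #>\<^bsub>P\<^esub> e [b] \<in> p_pow p D (osuc b)"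
  then have "psi [b] (e [b]) \<in> \<int>"
    using p_pow_D_imp_Q[OF e_carrier] b osuc_greater by (force simp: Q_def)
  then obtain k :: int where "1 / real p = of_int k"
    using b by (auto simp: psi_e elim: Ints_cases)
  then have "real_of_int (int p * k) = of_int 1"
    using p_gt_1 by (simp add: field_simps)
  then have "int p * k = 1"
    by (simp only: of_int_eq_iff)
  then show False
    using p_gt_1 by (simp add: zmult_eq_1_iff)
qed

section \<open>Passage from D to E\<close>

sublocale E: plain_comm_group "E_grp p \<alpha>"
  unfolding plain_comm_group_def E_grp_def using D.p_pow_subgroup by (rule D.abelian_FactGroup)

lemma p_pow_E: "b \<le> \<alpha> \<Longrightarrow> p_pow p (E_grp p \<alpha>) b = (\<lambda>x. p_pow p D \<alpha> #>\<^bsub>D\<^esub> x) ` p_pow p D b"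
  unfolding E_grp_def by (rule D.p_pow_Mod)

lemma p_pow_E_alpha: "p_pow p (E_grp p \<alpha>) \<alpha> = {\<one>\<^bsub>E_grp p \<alpha>\<^esub>}"
proof -
  have "p_pow p D \<alpha> #>\<^bsub>D\<^esub> x = p_pow p D \<alpha>" if "x \<in> p_pow p D \<alpha>" for x
    using that subgroup.subset[OF D.p_pow_subgroup] by (intro D.coset_join2 D.p_pow_subgroup) blast
  then show ?thesis
    using subgroup.one_closed[OF D.p_pow_subgroup[of p \<alpha>]]
    unfolding p_pow_E[OF order_refl] by (auto simp: E_grp_def)
qed

text \<open>The class of \<open>e [b]\<close> witnesses the drop in \<open>D\<close>; it survives in
  E because \<open>osuc b \<le> \<alpha>\<close> puts the subgroup divided out inside
  \<open>p_pow p D (osuc b)\<close>.\<close>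

lemma p_pow_E_strict:
  assumes "b < \<alpha>"
  shows "p_pow p (E_grp p \<alpha>) (osuc b) \<noteq> p_pow p (E_grp p \<alpha>) b"
proof
  let ?N = "p_pow p D \<alpha>" and ?e = "R #>\<^bsub>P\<^esub> e [b]"
  have sb: "osuc b \<le> \<alpha>"
    using assms by (rule osuc_least)
  assume eq: "p_pow p (E_grp p \<alpha>) (osuc b) = p_pow p (E_grp p \<alpha>) b"
  have e: "?e \<in> p_pow p D b"
    using assms by (intro e_in_p_pow_D) (auto simp: diamond_def)
  then have "?N #>\<^bsub>D\<^esub> ?e \<in> p_pow p (E_grp p \<alpha>) (osuc b)"
    unfolding eq using assms by (simp add: p_pow_E)
  then obtain y where y: "?N #>\<^bsub>D\<^esub> ?e = ?N #>\<^bsub>D\<^esub> y" "y \<in> p_pow p D (osuc b)"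
    unfolding p_pow_E[OF sb] by (rule imageE)
  have "?e \<in> carrier D"
    using e subgroup.subset[OF D.p_pow_subgroup] by blast
  then have "?e \<in> ?N #>\<^bsub>D\<^esub> y"
    using y(1) D.rcos_self[OF _ D.p_pow_subgroup] by metis
  moreover have "?N \<subseteq> p_pow p D (osuc b)"
    using sb by (rule D.p_pow_antimono)
  ultimately have "?e \<in> p_pow p D (osuc b)"
    using y(2) subgroup.m_closed[OF D.p_pow_subgroup, of _ p "osuc b"] by (auto simp: r_coset_def)
  then show False
    using e_not_in_p_pow_D[OF assms] by blast
qed

lemma E_lim1_trivial: "lim1_trivial p (E_grp p \<alpha>)"
proof -
  have "lim1_trivial p D"
    unfolding D_eq by (rule normal.lim1_trivial_Mod[OF R_normal P_lim1_trivial])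
  moreover have "p_pow p D \<alpha> \<lhd> D"
    using D.p_pow_subgroup D.normal_iff_subgroup by blast
  ultimately show ?thesis
    unfolding E_grp_def by (intro normal.lim1_trivial_Mod)
qed

end

theorem theorem5p1:
  fixes p :: nat and \<alpha> :: "'o::{wellorder,no_top}"
  assumes "Factorial_Ring.prime p"
  shows "is_invseq (mult_seq p (E_grp p \<alpha>)) \<and>
    is_local (mult_seq p (E_grp p \<alpha>)) \<and>
    has_len (mult_seq p (E_grp p \<alpha>)) \<alpha>"
proof -
  interpret tree_presentation p \<alpha>
    by unfold_locales (rule assms)
  show ?thesis
    using E.mult_seq_invseq E.is_local_mult_seq[OF p_pow_E_alpha E_lim1_trivial]
      E.has_len_mult_seq[OF p_pow_E_alpha p_pow_E_strict] by blast
qed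

end
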